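(* Let $\delta^0>0$ be a given accuracy parameter. Let $f:\mathbb{R}^n\to\mathbb{R}$ be strongly convex with a constant $\mu_f>0$, and suppose there exist a point $\bar x\in\mathbb{R}^n$ and $\epsilon>0$ such that $\langle a_j,\bar x\rangle-b_j\le-\epsilon$ for all $j=1,\ldots,m$. Let $L=L(c,\epsilon)$ be the subgradient bound defined in the context, with some $c>2\mu_f\alpha_{\min}\delta^0$. Let the penalty parameters $\gamma>0$ and $\delta$ be chosen such that $$0<\delta<\min\left\{\epsilon,\frac{16\alpha_{\min}^2}{\beta^2m^2}\right\},\qquad \Gamma\le\gamma\le\frac{2\mu_f\alpha_{\min}\delta^0}{\delta},$$ where $$\Gamma=\max\left\{L\left(\frac{1}{m\beta}-\frac{\sqrt{\delta}}{4\alpha_{\min}}\right)^{-1},\ 4mL\alpha_{\max}\left(\frac{1}{\sqrt{\delta}}+\frac{\beta m}{\alpha_{\min}}\right)\right\}.$$ Then the original problem $\min_{x\in X}f(x)$ and the penalized problem $\min_{x\in\mathbb{R}^n}F_{\gamma\delta}(x)$ have unique solutions, $x^*$ and $x^*_{\gamma\delta}$ respectively, and they satisfy $$\|x^*_{\gamma\delta}-x^*\|^2\le\delta^0.$$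
   Context: Original problem: minimize a convex function $f:\mathbb{R}^n\to\mathbb{R}$ subject to $\langle a_i,x\rangle-b_i\le0$, $i=1,\ldots,m$ ($m\ge2$), where $a_i\in\mathbb{R}^n$ are nonzero and $b_i\in\mathbb{R}$. The problem is feasible. Put $X_i=\{x\in\mathbb{R}^n\mid\langle a_i,x\rangle-b_i\le0\}$ and $X=\cap_{i=1}^mX_i$. Norms are Euclidean, $\Pi_Y[x]$ is the Euclidean projection onto a closed convex set $Y$, and $\mathrm{dist}(x,Y)=\|x-\Pi_Y[x]\|$. For nonzero $a\in\mathbb{R}^n$, $b\in\mathbb{R}$ and $\delta>0$: $h_\delta(x;a,b)=\frac{\langle a,x\rangle-b}{\|a\|}$ if $\langle a,x\rangle-b>\delta$; $h_\delta(x;a,b)=\frac{(\langle a,x\rangle-b+\delta)^2}{4\delta\|a\|}$ if $-\delta\le\langle a,x\rangle-b\le\delta$; $h_\delta(x;a,b)=0$ if $\langle a,x\rangle-b<-\delta$. Penalized objective: $F_{\gamma\delta}(x)=f(x)+\frac{\gamma}{m}\sum_{i=1}^mh_\delta(x;a_i,b_i)$. $X^*_{\gamma\delta}$ is the set of minimizers of $F_{\gamma\delta}$ over $\mathbb{R}^n$. $\alpha_{\min}=\min_j\|a_j\|$, $\alpha_{\max}=\max_j\|a_j\|$. Strong convexity with constant $\mu_f$ means $f(y)\ge f(x)+\langle s,y-x\rangle+\frac{\mu_f}{2}\|y-x\|^2$ for all $x,y$ and $s\in\partial f(x)$. Hoffman's constant: $\beta=\beta(a_1,\ldots,a_m)>0$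 is a constant depending only on $a_1,\ldots,a_m$ (not on the right-hand sides) such that, for every choice of right-hand sides $b'_1,\ldots,b'_m\in\mathbb{R}$ for which $Y=\cap_iY_i\ne\emptyset$ with $Y_i=\{x\mid\langle a_i,x\rangle\le b'_i\}$, one has $\beta\sum_{i=1}^m\mathrm{dist}(x,Y_i)\ge\mathrm{dist}(x,Y)$ for all $x\in\mathbb{R}^n$ (in particular for $X_i$ and $X$). Subgradient bound: $R(c,\epsilon)>0$ is a radius such that, for all $\gamma>0$ and $0<\delta\le\epsilon$ with $\gamma\delta\le c$ and every $x\in X^*_{\gamma\delta}$, the ball $\{z\mid\|z\|\le R(c,\epsilon)\}$ contains $\Pi_X[x]$ and every feasible point $x_{in}\in X$ satisfying $\|x-x_{in}\|\le\|x-\Pi_X[x]\|+\frac{\beta m\delta}{\alpha_{\min}}$ (such a radius exists when $f$ has bounded level sets, in particular when $f$ is strongly convex). Then $L(c,\epsilon)=\max\{\|s\|\mid s\in\partial f(x),\ \|x\|\le R(c,\epsilon)\}$, where $\partial f(x)$ is the subdifferential. *)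

theory Defs
  imports "HOL-Analysis.Analysis"
begin

definition subdifferential :: "('a::real_inner \<Rightarrow> real) \<Rightarrow> 'a \<Rightarrow> 'a set"
  where "subdifferential f x = {s. \<forall>y. f y \<ge> f x + s \<bullet> (y - x)}"

(* This quantifies over subgradients only, so it does not itself imply convexity. *)
definition strongly_convex :: "real \<Rightarrow> ('a::real_inner \<Rightarrow> real) \<Rightarrow> bool"
  where "strongly_convex \<mu> f \<longleftrightarrow>
    (\<forall>x y. \<forall>s\<in>subdifferential f x. f y \<ge> f x + s \<bullet> (y - x) + \<mu> / 2 * (norm (y - x))\<^sup>2)"

definition minimizers :: "('a \<Rightarrow> real) \<Rightarrow> 'a set \<Rightarrow> 'a set"
  where "minimizers f S = {x. is_arg_min f (\<lambda>z. z \<in> S) x}"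

definition proj_dist :: "'a::{real_inner,heine_borel} \<Rightarrow> 'a set \<Rightarrow> real"
  where "proj_dist x Y = norm (x - closest_point Y x)"

definition halfspace_le :: "'a::real_inner \<Rightarrow> real \<Rightarrow> 'a set"
  where "halfspace_le a b = {x. a \<bullet> x - b \<le> 0}"

(* The m constraints are indexed by {1..m}; values of a and b at other indices are irrelevant. *)
definition feasible_set :: "nat \<Rightarrow> (nat \<Rightarrow> 'a::real_inner) \<Rightarrow> (nat \<Rightarrow> real) \<Rightarrow> 'a set"
  where "feasible_set m a b = (\<Inter>i\<in>{1..m}. halfspace_le (a i) (b i))"

definition h_penalty :: "real \<Rightarrow> 'a::real_inner \<Rightarrow> real \<Rightarrow> 'a \<Rightarrow> real"
  where "h_penalty \<delta> a b x =
    (if a \<bullet> x - b > \<delta> then (a \<bullet> x - b) / norm a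
     else if - \<delta> \<le> a \<bullet> x - b then (a \<bullet> x - b + \<delta>)\<^sup>2 / (4 * \<delta> * norm a)
     else 0)"

definition penalized_objective ::
    "('a::real_inner \<Rightarrow> real) \<Rightarrow> nat \<Rightarrow> (nat \<Rightarrow> 'a) \<Rightarrow> (nat \<Rightarrow> real) \<Rightarrow> real \<Rightarrow> real \<Rightarrow> 'a \<Rightarrow> real"
  where "penalized_objective f m a b \<gamma> \<delta> x =
    f x + \<gamma> / real m * (\<Sum>i=1..m. h_penalty \<delta> (a i) (b i) x)"

definition alpha_min :: "nat \<Rightarrow> (nat \<Rightarrow> 'a::real_inner) \<Rightarrow> real"
  where "alpha_min m a = (MIN j\<in>{1..m}. norm (a j))"

definition alpha_max :: "nat \<Rightarrow> (nat \<Rightarrow> 'a::real_inner) \<Rightarrow> real"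
  where "alpha_max m a = (MAX j\<in>{1..m}. norm (a j))"

definition hoffman_constant :: "nat \<Rightarrow> (nat \<Rightarrow> 'a::{real_inner,heine_borel}) \<Rightarrow> real \<Rightarrow> bool"
  where "hoffman_constant m a \<beta> \<longleftrightarrow> \<beta> > 0 \<and>
    (\<forall>b'. feasible_set m a b' \<noteq> {} \<longrightarrow>
      (\<forall>x. \<beta> * (\<Sum>i=1..m. proj_dist x (halfspace_le (a i) (b' i)))
            \<ge> proj_dist x (feasible_set m a b')))"

definition subgradient_radius ::
    "('a::{real_inner,heine_borel} \<Rightarrow> real) \<Rightarrow> nat \<Rightarrow> (nat \<Rightarrow> 'a) \<Rightarrow> (nat \<Rightarrow> real)
      \<Rightarrow> real \<Rightarrow> real \<Rightarrow> real \<Rightarrow> real \<Rightarrow> bool"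
  where "subgradient_radius f m a b \<beta> c \<epsilon> R \<longleftrightarrow> R > 0 \<and>
    (\<forall>\<gamma> \<delta>. \<gamma> > 0 \<longrightarrow> 0 < \<delta> \<longrightarrow> \<delta> \<le> \<epsilon> \<longrightarrow> \<gamma> * \<delta> \<le> c \<longrightarrow>
      (\<forall>x\<in>minimizers (penalized_objective f m a b \<gamma> \<delta>) UNIV.
        closest_point (feasible_set m a b) x \<in> cball 0 R \<and>
        (\<forall>x_in\<in>feasible_set m a b.
          norm (x - x_in) \<le> norm (x - closest_point (feasible_set m a b) x)
                             + \<beta> * real m * \<delta> / alpha_min m a
          \<longrightarrow> x_in \<in> cball 0 R)))"

(* For convex f on a finite-dimensional space and R \<ge> 0 this set is nonempty and compact,
   so the supremum is attained, i.e. it is the maximum. *)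
definition subgradient_bound :: "('a::real_inner \<Rightarrow> real) \<Rightarrow> real \<Rightarrow> real"
  where "subgradient_bound f R = Sup {norm s | s x. s \<in> subdifferential f x \<and> norm x \<le> R}"

definition penalty_threshold :: "nat \<Rightarrow> (nat \<Rightarrow> 'a::real_inner) \<Rightarrow> real \<Rightarrow> real \<Rightarrow> real \<Rightarrow> real"
  where "penalty_threshold m a \<beta> L \<delta> =
    max (L * inverse (1 / (real m * \<beta>) - sqrt \<delta> / (4 * alpha_min m a)))
        (4 * real m * L * alpha_max m a * (1 / sqrt \<delta> + \<beta> * real m / alpha_min m a))"

end

theory Submission
  imports Defs
begin

text \<open>
  On its half-space the smoothed penalty is at most of order \<open>\<delta>\<close>, and everywhere
  it dominates the distance to that half-space. Everything about it comes from one representation: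
  up to the factor \<open>norm a\<close> it is, with \<open>t = a \<bullet> x - b\<close>, the
  maximum over \<open>u \<in> {0..1}\<close> of the affine functions
  \<open>u * (t + \<delta>) - \<delta> * u\<^sup>2\<close> of \<open>t\<close>. Hence it is convex,
  and evaluating at \<open>u = 0\<close>, \<open>u = 1/2\<close> and \<open>u = 1\<close> gives each
  lower bound that is needed.

  The heart of the proof is that the minimizer \<open>x\<close> of the penalized objective is
  feasible (\<open>penalized_minimizer_feasible\<close>). If not, let \<open>p\<close> be its
  projection onto the feasible set, at distance \<open>D > 0\<close>. Minimality of \<open>x\<close>
  and the Lipschitz bound by \<open>L\<close> say that moving to a feasible point \<open>z\<close>
  in the ball of radius \<open>R\<close> cannot lower the weighted penalty by more than
  \<open>L * norm (x - z)\<close>. Two choices of \<open>z\<close> contradict the two parts of the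
  threshold on \<open>\<gamma>\<close>. If \<open>D > sqrt \<delta>\<close>, take
  \<open>z = p\<close>: the penalties at \<open>x\<close> add up to at least
  \<open>D / \<beta>\<close> by Hoffman's inequality, and the residual penalty of order
  \<open>\<delta>\<close> at \<open>p\<close> is too small to cancel this, because the bound on
  \<open>\<delta>\<close> keeps its multiple of \<open>D * sqrt \<delta>\<close> below
  \<open>D / \<beta>\<close>. If \<open>D \<le> sqrt \<delta>\<close>, take for \<open>z\<close> the
  projection of \<open>p\<close> onto the constraints tightened by \<open>\<delta>\<close>, which
  \<open>x_bar\<close> shows to be consistent: there the penalty vanishes, by Hoffman's inequality
  the move is short, and the violated constraint alone has penalty above
  \<open>\<delta> / (4 * norm a)\<close> at \<open>x\<close>.

  Once \<open>x\<close> is feasible, strong convexity is applied twice. With \<open>x_star\<close>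
  the constrained minimizer, \<open>f x\<close> exceeds \<open>f x_star\<close>, and the penalized
  objective at \<open>x_star\<close> exceeds the one at \<open>x\<close>, each by at least
  \<open>\<mu> / 4 * (norm (x - x_star))\<^sup>2\<close>
  (\<open>minimizer_quadratic_growth\<close>). Adding up, only the penalty of the feasible point
  \<open>x_star\<close> remains, at most \<open>\<gamma> * \<delta> / (4 * alpha_min m a)\<close>,
  which the upper bound on \<open>\<gamma>\<close> controls.
\<close>

section \<open>Subgradients of convex functions\<close>

text \<open>
  A hyperplane separating \<open>(x, f x)\<close> from the strict epigraph cannot be vertical, since every
  \<open>z\<close> lies below a point of the strict epigraph; so it is the graph of an affine minorant
  touching \<open>f\<close> at \<open>x\<close>.
\<close>
lemma subdifferential_nonempty:
  fixes f :: "'a::euclidean_space \<Rightarrow> real"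
  assumes conv: "convex_on UNIV f"
  shows "subdifferential f x \<noteq> {}"
proof -
  define T where "T = {zr :: 'a \<times> real. f (fst zr) < snd zr}"
  have "convex T"
    unfolding convex_def
  proof (intro ballI allI impI)
    fix p q :: "'a \<times> real" and u v :: real
    assume pq: "p \<in> T" "q \<in> T" and uv: "0 \<le> u" "0 \<le> v" "u + v = 1"
    have "f (u *\<^sub>R fst p + v *\<^sub>R fst q) \<le> u * f (fst p) + v * f (fst q)"
      using conv uv unfolding convex_on_def by blast
    also have "\<dots> < u * snd p + v * snd q"
    proof (cases "u = 0")
      case True
      then show ?thesis using pq uv by (simp add: T_def)
    next
      case False
      then have "u * f (fst p) < u * snd p" using pq uv by (simp add: T_def)
      moreover have "v * f (fst q) \<le> v * snd q"
        using pq uv by (intro mult_left_mono) (auto simp: T_def)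
      ultimately show ?thesis by linarith
    qed
    finally show "u *\<^sub>R p + v *\<^sub>R q \<in> T" by (simp add: T_def)
  qed
  moreover have "(x, f x + 1) \<in> T" by (simp add: T_def)
  then have "T \<noteq> {}" by blast
  moreover have "{(x, f x)} \<inter> T = {}" by (simp add: T_def)
  ultimately have "\<exists>w c. w \<noteq> 0 \<and> (\<forall>q\<in>{(x, f x)}. w \<bullet> q \<le> c) \<and> (\<forall>q\<in>T. w \<bullet> q \<ge> c)"
    by (intro separating_hyperplane_sets) auto
  then obtain w c where w: "w \<noteq> 0" "w \<bullet> (x, f x) \<le> c" "\<And>q. q \<in> T \<Longrightarrow> w \<bullet> q \<ge> c"
    by blast
  obtain s t where st: "w = (s, t)" by (cases w)
  have sep: "s \<bullet> x + t * f x \<le> s \<bullet> z + t * r" if "f z < r" for z r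
    using w(2) w(3)[of "(z, r)"] that by (simp add: st T_def)
  have "t \<ge> 0" using sep[of x "f x + 1"] by (simp add: algebra_simps)
  moreover have "t \<noteq> 0"
  proof
    assume "t = 0"
    then have "s \<bullet> x \<le> s \<bullet> (x - s)" using sep[of "x - s" "f (x - s) + 1"] by simp
    then have "s \<bullet> s \<le> 0" by (simp add: inner_diff_right)
    then have "s = 0" by (metis inner_ge_zero inner_eq_zero_iff order_antisym)
    then show False using w(1) st \<open>t = 0\<close> by (simp add: zero_prod_def)
  qed
  ultimately have t: "t > 0" by simp
  have "f z \<ge> f x + (- (1 / t) *\<^sub>R s) \<bullet> (z - x)" for z
  proof (rule dense_ge)
    fix r assume "f z < r"
    from sep[OF this] t show "f x + (- (1 / t) *\<^sub>R s) \<bullet> (z - x) \<le> r"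
      by (simp add: field_simps inner_diff_right)
  qed
  then have "- (1 / t) *\<^sub>R s \<in> subdifferential f x" by (simp add: subdifferential_def)
  then show ?thesis by blast
qed

text \<open>
  A unit step from \<open>x\<close> in the direction of a subgradient \<open>s\<close> raises \<open>f\<close> by at least \<open>norm s\<close>, so
  the oscillation of \<open>f\<close> on the ball of radius \<open>R + 1\<close> bounds the subgradients on the ball of
  radius \<open>R\<close>; without this boundedness the supremum in \<open>subgradient_bound\<close> would be arbitrary.
\<close>
lemma norm_subgradient_le_bound:
  fixes f :: "'a::euclidean_space \<Rightarrow> real"
  assumes conv: "convex_on UNIV f" and s: "s \<in> subdifferential f x" and x: "norm x \<le> R"
  shows "norm s \<le> subgradient_bound f R"
proof -
  have "continuous_on UNIV f" using conv by (simp add: convex_on_continuous)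
  then have "continuous_on (cball 0 (R + 1)) f" by (rule continuous_on_subset) simp
  then have "bounded (f ` cball 0 (R + 1))"
    by (intro compact_imp_bounded compact_continuous_image) auto
  then obtain B where "\<forall>z\<in>cball 0 (R + 1). \<bar>f z\<bar> \<le> B"
    unfolding bounded_iff by auto
  then have B: "\<bar>f z\<bar> \<le> B" if "norm z \<le> R + 1" for z using that by simp
  have "norm s' \<le> 2 * B" if s': "s' \<in> subdifferential f y" and y: "norm y \<le> R" for s' y
  proof -
    have "f y + s' \<bullet> ((y + sgn s') - y) \<le> f (y + sgn s')"
      using s' unfolding subdifferential_def by blast
    moreover have "s' \<bullet> sgn s' = norm s'"
      by (cases "s' = 0") (simp_all add: sgn_div_norm power2_norm_eq_inner[symmetric] power2_eq_square)
    moreover have "norm (y + sgn s') \<le> R + 1"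
      using y norm_triangle_ineq[of y "sgn s'"] by (auto simp: norm_sgn split: if_splits)
    ultimately show ?thesis using B[of y] B[of "y + sgn s'"] y by (simp add: abs_le_iff)
  qed
  then have "bdd_above {norm s | s x. s \<in> subdifferential f x \<and> norm x \<le> R}"
    by (intro bdd_aboveI[of _ "2 * B"]) auto
  then show ?thesis
    unfolding subgradient_bound_def using s x by (intro cSup_upper) auto
qed

lemma convex_decrease_le_bound:
  fixes f :: "'a::euclidean_space \<Rightarrow> real"
  assumes conv: "convex_on UNIV f" and z: "norm z \<le> R"
  shows "f z - f x \<le> subgradient_bound f R * norm (x - z)"
proof -
  obtain s where s: "s \<in> subdifferential f z" using subdifferential_nonempty[OF conv] by blast
  then have "f z + s \<bullet> (x - z) \<le> f x" by (simp add: subdifferential_def)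
  moreover have "- (norm s * norm (x - z)) \<le> s \<bullet> (x - z)"
    using Cauchy_Schwarz_ineq2[of s "x - z"] by (simp add: abs_le_iff)
  moreover have "norm s * norm (x - z) \<le> subgradient_bound f R * norm (x - z)"
    using norm_subgradient_le_bound[OF conv s z] by (intro mult_right_mono) auto
  ultimately show ?thesis by linarith
qed

section \<open>Minimizing strongly convex functions\<close>

text \<open>
  Strong convexity at the midpoint, the only instance of the Jensen form used below. It passes
  from \<open>f\<close> to the sum with any convex function, without describing the subgradients of the sum.
\<close>
definition midpoint_strongly_convex :: "real \<Rightarrow> ('a::real_normed_vector \<Rightarrow> real) \<Rightarrow> bool"
  where "midpoint_strongly_convex \<mu> \<phi> \<longleftrightarrow>
    (\<forall>x y. \<phi> (midpoint x y) \<le> (\<phi> x + \<phi> y) / 2 - \<mu> / 8 * (norm (x - y))\<^sup>2)"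

text \<open>
  For \<open>f\<close>, the inequalities at \<open>x\<close> and \<open>y\<close> for a common subgradient at the midpoint are added;
  its linear contributions cancel.
\<close>
lemma midpoint_strongly_convex_add:
  fixes f g :: "'a::euclidean_space \<Rightarrow> real"
  assumes conv: "convex_on UNIV f" and strong: "strongly_convex \<mu> f" and g: "convex_on UNIV g"
  shows "midpoint_strongly_convex \<mu> (\<lambda>x. f x + g x)"
  unfolding midpoint_strongly_convex_def
proof (intro allI)
  fix x y :: 'a
  define z where "z = midpoint x y"
  obtain s where s: "s \<in> subdifferential f z" using subdifferential_nonempty[OF conv] by blast
  define w where "w = (1/2) *\<^sub>R (x - y)"
  have xz: "x - z = w" and yz: "y - z = - w"
    by (auto simp: w_def z_def midpoint_def algebra_simps simp flip: scaleR_add_left)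
  have w: "(norm w)\<^sup>2 = (norm (x - y))\<^sup>2 / 4" by (simp add: w_def power_divide)
  have "f x \<ge> f z + s \<bullet> (x - z) + \<mu> / 2 * (norm (x - z))\<^sup>2"
       "f y \<ge> f z + s \<bullet> (y - z) + \<mu> / 2 * (norm (y - z))\<^sup>2"
    using strong s unfolding strongly_convex_def by blast+
  then have "f z \<le> (f x + f y) / 2 - \<mu> / 8 * (norm (x - y))\<^sup>2"
    unfolding xz yz by (simp add: w field_simps)
  moreover have "g ((1/2) *\<^sub>R x + (1/2) *\<^sub>R y) \<le> (1/2) * g x + (1/2) * g y"
    using convex_onD[OF g, of "1/2" x y] by simp
  then have "g z \<le> (g x + g y) / 2"
    by (simp add: z_def midpoint_def scaleR_add_right field_simps)
  ultimately show "f (midpoint x y) + g (midpoint x y)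
      \<le> (f x + g x + (f y + g y)) / 2 - \<mu> / 8 * (norm (x - y))\<^sup>2"
    by (simp add: z_def field_simps)
qed

lemma minimizers_memD:
  assumes "x \<in> minimizers \<phi> S"
  shows "x \<in> S" and "y \<in> S \<Longrightarrow> \<phi> x \<le> \<phi> y"
  using assms by (auto simp: minimizers_def is_arg_min_def not_less)

text \<open>The midpoint of a minimizer and a competitor is again a competitor.\<close>
lemma minimizer_quadratic_growth:
  assumes mid: "midpoint_strongly_convex \<mu> \<phi>" and S: "convex S"
    and x: "x \<in> minimizers \<phi> S" and y: "y \<in> S"
  shows "\<phi> x + \<mu> / 4 * (norm (x - y))\<^sup>2 \<le> \<phi> y"
proof -
  have "midpoint x y \<in> S"
    using convexD[OF S minimizers_memD(1)[OF x] y, of "1/2" "1/2"]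
    by (simp add: midpoint_def scaleR_add_right)
  then have "\<phi> x \<le> \<phi> (midpoint x y)" by (rule minimizers_memD(2)[OF x])
  also have "\<dots> \<le> (\<phi> x + \<phi> y) / 2 - \<mu> / 8 * (norm (x - y))\<^sup>2"
    using mid unfolding midpoint_strongly_convex_def by blast
  finally show ?thesis by (simp add: field_simps)
qed

text \<open>
  A subgradient at \<open>x\<close>, evaluated at the midpoint of \<open>x\<close> and \<open>y\<close>, shows that \<open>\<phi>\<close> grows
  quadratically; so the search may be restricted to a compact ball around any point of \<open>S\<close>.
\<close>
lemma minimizers_singleton:
  fixes \<phi> :: "'a::euclidean_space \<Rightarrow> real"
  assumes conv: "convex_on UNIV \<phi>" and mid: "midpoint_strongly_convex \<mu> \<phi>" and mu: "\<mu> > 0"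
    and S: "convex S" "closed S" "S \<noteq> {}"
  shows "\<exists>x. minimizers \<phi> S = {x}"
proof -
  obtain x0 where x0: "x0 \<in> S" using S by blast
  obtain s where s: "s \<in> subdifferential \<phi> x0" using subdifferential_nonempty[OF conv] by blast
  \<comment> \<open>Beyond this radius the quadratic term \<open>\<mu> / 4 * (norm (x0 - y))\<^sup>2\<close> outweighs the linear one.\<close>
  define r where "r = 4 * norm s / \<mu>"
  have far: "\<phi> x0 < \<phi> y" if y: "norm (x0 - y) > r" for y
  proof -
    have "\<phi> x0 + s \<bullet> (midpoint x0 y - x0) \<le> \<phi> (midpoint x0 y)"
      using s by (simp add: subdifferential_def)
    also have "\<dots> \<le> (\<phi> x0 + \<phi> y) / 2 - \<mu> / 8 * (norm (x0 - y))\<^sup>2"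
      using mid unfolding midpoint_strongly_convex_def by blast
    finally have "\<phi> x0 + s \<bullet> (midpoint x0 y - x0)
        \<le> (\<phi> x0 + \<phi> y) / 2 - \<mu> / 8 * (norm (x0 - y))\<^sup>2" .
    moreover have "midpoint x0 y - x0 = - ((1/2) *\<^sub>R (x0 - y))"
      by (simp add: midpoint_def algebra_simps flip: scaleR_add_left)
    then have "s \<bullet> (midpoint x0 y - x0) = - (s \<bullet> (x0 - y)) / 2"
      by (simp only: inner_minus_right inner_scaleR_right)
    ultimately have 1: "\<phi> x0 - s \<bullet> (x0 - y) + \<mu> / 4 * (norm (x0 - y))\<^sup>2 \<le> \<phi> y"
      by argo
    have 2: "s \<bullet> (x0 - y) \<le> norm s * norm (x0 - y)" by (rule norm_cauchy_schwarz)
    have "norm s < \<mu> / 4 * norm (x0 - y)" using y mu by (simp add: r_def field_simps)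
    moreover have "0 \<le> r" using mu by (simp add: r_def)
    with y have "0 < norm (x0 - y)" by linarith
    ultimately have "norm s * norm (x0 - y) < \<mu> / 4 * norm (x0 - y) * norm (x0 - y)"
      by (rule mult_strict_right_mono)
    with 1 2 show ?thesis by (simp add: power2_eq_square)
  qed
  have "continuous_on UNIV \<phi>" using conv by (simp add: convex_on_continuous)
  then have "continuous_on (S \<inter> cball x0 r) \<phi>" by (rule continuous_on_subset) simp
  moreover have "compact (S \<inter> cball x0 r)" using S by (simp add: closed_Int_compact)
  moreover have "x0 \<in> S \<inter> cball x0 r" using x0 mu by (simp add: r_def)
  ultimately obtain x where x: "x \<in> S \<inter> cball x0 r" "\<And>y. y \<in> S \<inter> cball x0 r \<Longrightarrow> \<phi> x \<le> \<phi> y"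
    using continuous_attains_inf[of "S \<inter> cball x0 r" \<phi>] by blast
  have "\<phi> x \<le> \<phi> y" if "y \<in> S" for y
  proof (cases "norm (x0 - y) \<le> r")
    case True
    then show ?thesis using x(2) that by (simp add: dist_norm)
  next
    case False
    then show ?thesis using far[of y] x(2)[OF \<open>x0 \<in> S \<inter> cball x0 r\<close>] by linarith
  qed
  then have xmin: "x \<in> minimizers \<phi> S"
    using x(1) by (auto simp: minimizers_def is_arg_min_def not_less)
  moreover have "y = x" if y: "y \<in> minimizers \<phi> S" for y
  proof -
    have "\<mu> / 4 * (norm (x - y))\<^sup>2 \<le> 0"
      using minimizer_quadratic_growth[OF mid S(1) xmin minimizers_memD(1)[OF y]]
        minimizers_memD(2)[OF y minimizers_memD(1)[OF xmin]] by linarith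
    then show ?thesis using mu by (simp add: mult_le_0_iff)
  qed
  ultimately show ?thesis by blast
qed

section \<open>The smoothed penalty\<close>

text \<open>
  The next two lemmas together express the penalty as a maximum of affine functions. The gap
  to the affine function with parameter \<open>u\<close> is \<open>\<delta>\<close> times a square in the quadratic region.
\<close>
lemma h_penalty_ge_affine:
  assumes d: "\<delta> > 0" and a: "a \<noteq> 0" and u: "0 \<le> u" "u \<le> 1"
  shows "u * (a \<bullet> x - b + \<delta>) - \<delta> * u\<^sup>2 \<le> norm a * h_penalty \<delta> a b x"
proof -
  define t where "t = a \<bullet> x - b"
  have h: "norm a * h_penalty \<delta> a b x =
      (if t > \<delta> then t else if - \<delta> \<le> t then (t + \<delta>)\<^sup>2 / (4 * \<delta>) else 0)"
    using a by (simp add: h_penalty_def t_def)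
  consider "t > \<delta>" | "- \<delta> \<le> t" "t \<le> \<delta>" | "t < - \<delta>" by linarith
  then have "u * (t + \<delta>) - \<delta> * u\<^sup>2
      \<le> (if t > \<delta> then t else if - \<delta> \<le> t then (t + \<delta>)\<^sup>2 / (4 * \<delta>) else 0)"
  proof cases
    case 1
    have "t - (u * (t + \<delta>) - \<delta> * u\<^sup>2) = (1 - u) * (t - \<delta> * u)"
      by (simp add: algebra_simps power2_eq_square)
    moreover have "\<delta> * u \<le> \<delta> * 1" using d u by (intro mult_left_mono) auto
    then have "0 \<le> (1 - u) * (t - \<delta> * u)" using u 1 by (intro mult_nonneg_nonneg) auto
    ultimately show ?thesis using 1 by simp
  next
    case 2
    have "(t + \<delta>)\<^sup>2 / (4 * \<delta>) - (u * (t + \<delta>) - \<delta> * u\<^sup>2) = (t + \<delta> - 2 * \<delta> * u)\<^sup>2 / (4 * \<delta>)"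
      using d by (simp add: field_simps power2_eq_square)
    moreover have "0 \<le> (t + \<delta> - 2 * \<delta> * u)\<^sup>2 / (4 * \<delta>)" using d by simp
    ultimately have "u * (t + \<delta>) - \<delta> * u\<^sup>2 \<le> (t + \<delta>)\<^sup>2 / (4 * \<delta>)" by linarith
    then show ?thesis using 2 by simp
  next
    case 3
    then have "u * (t + \<delta>) \<le> 0" using u by (simp add: mult_le_0_iff)
    moreover have "0 \<le> \<delta> * u\<^sup>2" using d by simp
    ultimately have "u * (t + \<delta>) - \<delta> * u\<^sup>2 \<le> 0" by linarith
    then show ?thesis using 3 d by simp
  qed
  then show ?thesis unfolding h by (simp add: t_def)
qed

lemma h_penalty_eq_affine:
  assumes d: "\<delta> > 0" and a: "a \<noteq> 0"
  obtains u where "0 \<le> u" "u \<le> 1"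
    "norm a * h_penalty \<delta> a b x = u * (a \<bullet> x - b + \<delta>) - \<delta> * u\<^sup>2"
proof -
  define t where "t = a \<bullet> x - b"
  consider "t > \<delta>" | "- \<delta> \<le> t" "t \<le> \<delta>" | "t < - \<delta>" by linarith
  then show ?thesis
  proof cases
    case 1
    then show ?thesis using a by (intro that[of 1]) (auto simp: h_penalty_def t_def)
  next
    case 2
    \<comment> \<open>The vertex of the parabola \<open>u * (t + \<delta>) - \<delta> * u\<^sup>2\<close> in \<open>u\<close>.\<close>
    define u where "u = (t + \<delta>) / (2 * \<delta>)"
    have "norm a * h_penalty \<delta> a b x = (t + \<delta>)\<^sup>2 / (4 * \<delta>)"
      using 2 a by (simp add: h_penalty_def t_def)
    also have "\<dots> = u * (t + \<delta>) - \<delta> * u\<^sup>2"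
      using d by (simp add: u_def field_simps power2_eq_square)
    finally show ?thesis
      using 2 d by (intro that[of u]) (auto simp: u_def t_def)
  next
    case 3
    then show ?thesis using d by (intro that[of 0]) (auto simp: h_penalty_def t_def)
  qed
qed

lemma h_penalty_nonneg:
  assumes "\<delta> > 0" "a \<noteq> 0"
  shows "0 \<le> h_penalty \<delta> a b x"
  using h_penalty_ge_affine[OF assms, of 0] assms by (simp add: zero_le_mult_iff)

lemma h_penalty_ge_distance:
  assumes "\<delta> > 0" "a \<noteq> 0"
  shows "max 0 (a \<bullet> x - b) / norm a \<le> h_penalty \<delta> a b x"
  using h_penalty_ge_affine[OF assms, of 1 x b] h_penalty_nonneg[OF assms, of b x] assms
  by (auto simp: max_def field_simps)

lemma h_penalty_infeasible_gt:
  assumes "\<delta> > 0" "a \<noteq> 0" "a \<bullet> x - b > 0"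
  shows "\<delta> / (4 * norm a) < h_penalty \<delta> a b x"
proof -
  have "\<delta> / 4 < norm a * h_penalty \<delta> a b x"
    using h_penalty_ge_affine[OF assms(1,2), of "1/2" x b] assms(3)
    by (simp add: power2_eq_square field_simps)
  then show ?thesis using assms by (simp add: field_simps)
qed

lemma h_penalty_feasible_le:
  assumes d: "\<delta> > 0" and a: "a \<noteq> 0" and x: "x \<in> halfspace_le a b"
  shows "h_penalty \<delta> a b x \<le> \<delta> / (4 * norm a)"
proof -
  obtain u where u: "0 \<le> u" "u \<le> 1"
    "norm a * h_penalty \<delta> a b x = u * (a \<bullet> x - b + \<delta>) - \<delta> * u\<^sup>2"
    using h_penalty_eq_affine[OF d a] .
  have "u * (a \<bullet> x - b) \<le> 0" using u x by (simp add: halfspace_le_def mult_le_0_iff)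
  \<comment> \<open>The bound \<open>1/4\<close> is the maximum of \<open>u * (1 - u)\<close>.\<close>
  moreover have "0 \<le> \<delta> * (u - 1/2)\<^sup>2" using d by simp
  ultimately have "norm a * h_penalty \<delta> a b x \<le> \<delta> / 4"
    unfolding u(3) by (simp add: power2_eq_square algebra_simps)
  then show ?thesis using a by (simp add: field_simps)
qed

lemma h_penalty_tightened_eq_0:
  assumes d: "\<delta> > 0" and x: "x \<in> halfspace_le a (b - \<delta>)"
  shows "h_penalty \<delta> a b x = 0"
  using assms by (auto simp: h_penalty_def halfspace_le_def)

lemma convex_on_h_penalty:
  fixes a :: "'a::real_inner"
  assumes d: "\<delta> > 0" and a: "a \<noteq> 0"
  shows "convex_on UNIV (h_penalty \<delta> a b)"
proof (intro convex_onI)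
  fix v :: real and x y :: 'a
  assume v: "0 < v" "v < 1"
  let ?z = "(1 - v) *\<^sub>R x + v *\<^sub>R y" and ?h = "\<lambda>x. norm a * h_penalty \<delta> a b x"
  obtain u where u: "0 \<le> u" "u \<le> 1" "?h ?z = u * (a \<bullet> ?z - b + \<delta>) - \<delta> * u\<^sup>2"
    using h_penalty_eq_affine[OF d a] .
  have "?h ?z = (1 - v) * (u * (a \<bullet> x - b + \<delta>) - \<delta> * u\<^sup>2)
      + v * (u * (a \<bullet> y - b + \<delta>) - \<delta> * u\<^sup>2)"
    unfolding u(3) by (simp add: inner_add_right algebra_simps)
  also have "\<dots> \<le> (1 - v) * ?h x + v * ?h y"
    using v h_penalty_ge_affine[OF d a u(1,2)] by (intro add_mono mult_left_mono) auto
  finally have "norm a * h_penalty \<delta> a b ?z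
      \<le> norm a * ((1 - v) * h_penalty \<delta> a b x + v * h_penalty \<delta> a b y)"
    by (simp add: algebra_simps)
  then show "h_penalty \<delta> a b ?z \<le> (1 - v) * h_penalty \<delta> a b x + v * h_penalty \<delta> a b y"
    using a by simp
qed simp

lemma convex_on_sum_functions:
  assumes "\<And>i. i \<in> I \<Longrightarrow> convex_on UNIV (g i)"
  shows "convex_on UNIV (\<lambda>x. \<Sum>i\<in>I. g i x)"
  using assms
  by (induction I rule: infinite_finite_induct) (auto simp: convex_on_const intro: convex_on_add)

lemma convex_on_total_penalty:
  assumes "\<delta> > 0" "\<gamma> \<ge> 0" "\<forall>i\<in>{1..m}. a i \<noteq> 0"
  shows "convex_on UNIV (\<lambda>x. \<gamma> / real m * (\<Sum>i=1..m. h_penalty \<delta> (a i) (b i) x))"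
  using assms
  by (intro convex_on_cmul convex_on_sum_functions convex_on_h_penalty) auto

section \<open>Half-spaces and the feasible set\<close>

lemma closed_feasible_set: "closed (feasible_set m a b)"
  unfolding feasible_set_def halfspace_le_def by (auto intro!: closed_INT simp: closed_halfspace_le)

lemma convex_feasible_set: "convex (feasible_set m a b)"
  unfolding feasible_set_def halfspace_le_def by (auto intro!: convex_INT simp: convex_halfspace_le)

lemma feasible_setD: "x \<in> feasible_set m a b \<Longrightarrow> i \<in> {1..m} \<Longrightarrow> x \<in> halfspace_le (a i) (b i)"
  by (auto simp: feasible_set_def)

lemma proj_dist_halfspace_le:
  fixes a :: "'a::euclidean_space"
  assumes a: "a \<noteq> 0"
  shows "proj_dist x (halfspace_le a b) \<le> max 0 (a \<bullet> x - b) / norm a"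
proof -
  define k where "k = max 0 (a \<bullet> x - b) / (norm a)\<^sup>2"
  have cl: "closed (halfspace_le a b)" by (simp add: halfspace_le_def closed_halfspace_le)
  have "k * (a \<bullet> a) = max 0 (a \<bullet> x - b)"
    using a by (simp add: k_def power2_norm_eq_inner)
  then have "x - k *\<^sub>R a \<in> halfspace_le a b"
    by (auto simp: halfspace_le_def inner_diff_right)
  then have "dist x (closest_point (halfspace_le a b) x) \<le> dist x (x - k *\<^sub>R a)"
    by (rule closest_point_le[OF cl])
  also have "\<dots> = max 0 (a \<bullet> x - b) / norm a"
    using a by (simp add: dist_norm k_def power2_eq_square)
  finally show ?thesis by (simp add: proj_dist_def dist_norm)
qed

lemma alpha_min_le: "i \<in> {1..m} \<Longrightarrow> alpha_min m a \<le> norm (a i)"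
  by (simp add: alpha_min_def)

lemma alpha_max_ge: "i \<in> {1..m} \<Longrightarrow> norm (a i) \<le> alpha_max m a"
  by (simp add: alpha_max_def)

lemma alpha_min_pos:
  assumes "m \<ge> 1" "\<forall>i\<in>{1..m}. a i \<noteq> 0"
  shows "0 < alpha_min m a"
  using assms by (simp add: alpha_min_def)

lemma total_penalty_feasible_le:
  assumes d: "\<delta> > 0" and m: "m \<ge> 1" and a: "\<forall>i\<in>{1..m}. a i \<noteq> 0"
    and x: "x \<in> feasible_set m a b"
  shows "(\<Sum>i=1..m. h_penalty \<delta> (a i) (b i) x) \<le> real m * (\<delta> / (4 * alpha_min m a))"
proof -
  have "h_penalty \<delta> (a i) (b i) x \<le> \<delta> / (4 * alpha_min m a)" if i: "i \<in> {1..m}" for i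
  proof -
    have "h_penalty \<delta> (a i) (b i) x \<le> \<delta> / (4 * norm (a i))"
      using d bspec[OF a i] feasible_setD[OF x i] by (rule h_penalty_feasible_le)
    also have "\<dots> \<le> \<delta> / (4 * alpha_min m a)"
      using d alpha_min_le[OF i, of a] alpha_min_pos[OF m a] by (intro frac_le) auto
    finally show ?thesis .
  qed
  then show ?thesis using sum_bounded_above[of "{1..m}" _ "\<delta> / (4 * alpha_min m a)"] by simp
qed

text \<open>Hoffman's inequality, with the distances to the half-spaces bounded by the penalties.\<close>
lemma hoffman_total_penalty:
  fixes a :: "nat \<Rightarrow> 'a::euclidean_space"
  assumes hoff: "hoffman_constant m a \<beta>" and d: "\<delta> > 0"
    and a: "\<forall>i\<in>{1..m}. a i \<noteq> 0" and ne: "feasible_set m a b \<noteq> {}"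
  shows "proj_dist x (feasible_set m a b) \<le> \<beta> * (\<Sum>i=1..m. h_penalty \<delta> (a i) (b i) x)"
proof -
  have "proj_dist x (feasible_set m a b)
      \<le> \<beta> * (\<Sum>i=1..m. proj_dist x (halfspace_le (a i) (b i)))"
    using hoff ne by (simp add: hoffman_constant_def)
  also have "\<dots> \<le> \<beta> * (\<Sum>i=1..m. h_penalty \<delta> (a i) (b i) x)"
    using hoff d a
    by (intro mult_left_mono sum_mono order.trans[OF proj_dist_halfspace_le h_penalty_ge_distance])
      (auto simp: hoffman_constant_def)
  finally show ?thesis .
qed

text \<open>
  Because Hoffman's constant does not depend on the right-hand sides, it also controls how far
  a feasible point is from the constraints tightened by \<open>\<delta>\<close>, each of which it violates by at
  most \<open>\<delta>\<close>.
\<close>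
lemma tightened_point_near_feasible:
  fixes a :: "nat \<Rightarrow> 'a::euclidean_space"
  assumes hoff: "hoffman_constant m a \<beta>" and d: "\<delta> > 0" and m: "m \<ge> 1"
    and a: "\<forall>i\<in>{1..m}. a i \<noteq> 0"
    and ne: "feasible_set m a (\<lambda>i. b i - \<delta>) \<noteq> {}" and p: "p \<in> feasible_set m a b"
  obtains z where "z \<in> feasible_set m a (\<lambda>i. b i - \<delta>)"
    "norm (p - z) \<le> \<beta> * real m * \<delta> / alpha_min m a"
proof -
  let ?Y = "feasible_set m a (\<lambda>i. b i - \<delta>)"
  have "proj_dist p (halfspace_le (a i) (b i - \<delta>)) \<le> \<delta> / alpha_min m a" if i: "i \<in> {1..m}" for i
  proof -
    have "proj_dist p (halfspace_le (a i) (b i - \<delta>))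
        \<le> max 0 (a i \<bullet> p - (b i - \<delta>)) / norm (a i)"
      using bspec[OF a i] by (rule proj_dist_halfspace_le)
    also have "\<dots> \<le> \<delta> / norm (a i)"
      using feasible_setD[OF p i] d by (intro divide_right_mono) (auto simp: halfspace_le_def)
    also have "\<dots> \<le> \<delta> / alpha_min m a"
      using d alpha_min_le[OF i, of a] alpha_min_pos[OF m a] by (intro frac_le) auto
    finally show ?thesis .
  qed
  then have sum: "(\<Sum>i=1..m. proj_dist p (halfspace_le (a i) (b i - \<delta>)))
      \<le> real m * (\<delta> / alpha_min m a)"
    using sum_bounded_above[of "{1..m}" _ "\<delta> / alpha_min m a"] by simp
  have "proj_dist p ?Y \<le> \<beta> * (\<Sum>i=1..m. proj_dist p (halfspace_le (a i) (b i - \<delta>)))"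
    using hoff ne by (simp add: hoffman_constant_def)
  also have "\<dots> \<le> \<beta> * (real m * (\<delta> / alpha_min m a))"
    using sum hoff by (intro mult_left_mono) (auto simp: hoffman_constant_def)
  finally have "norm (p - closest_point ?Y p) \<le> \<beta> * real m * \<delta> / alpha_min m a"
    by (simp add: proj_dist_def)
  then show ?thesis using that closest_point_in_set[OF closed_feasible_set ne] by blast
qed

section \<open>Feasibility of the penalized minimizer\<close>

lemma penalty_drop_le_move:
  fixes f :: "'a::euclidean_space \<Rightarrow> real"
  assumes conv: "convex_on UNIV f"
    and x: "x \<in> minimizers (penalized_objective f m a b \<gamma> \<delta>) UNIV"
    and z: "norm z \<le> R"
  shows "\<gamma> / real m * ((\<Sum>i=1..m. h_penalty \<delta> (a i) (b i) x)
      - (\<Sum>i=1..m. h_penalty \<delta> (a i) (b i) z)) \<le> subgradient_bound f R * norm (x - z)"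
  using minimizers_memD(2)[OF x, of z] convex_decrease_le_bound[OF conv z, of x]
  by (simp add: penalized_objective_def right_diff_distrib)

text \<open>
  The assumption \<open>small\<close> makes the denominator in the first part of the threshold positive.
  Each case below violates one part strictly, which is why \<open>\<gamma>\<close> may equal the threshold.
\<close>
lemma penalized_minimizer_feasible:
  fixes f :: "'a::euclidean_space \<Rightarrow> real"
  assumes conv: "convex_on UNIV f" and hoff: "hoffman_constant m a \<beta>" and m: "m \<ge> 1"
    and a: "\<forall>i\<in>{1..m}. a i \<noteq> 0"
    and d: "\<delta> > 0" "\<delta> \<le> \<epsilon>" and g: "\<gamma> > 0" "\<gamma> * \<delta> \<le> c"
    and tight: "feasible_set m a (\<lambda>i. b i - \<delta>) \<noteq> {}"
    and small: "sqrt \<delta> / (4 * alpha_min m a) < 1 / (real m * \<beta>)"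
    and rad: "subgradient_radius f m a b \<beta> c \<epsilon> R"
    and thr: "penalty_threshold m a \<beta> (subgradient_bound f R) \<delta> \<le> \<gamma>"
    and x: "x \<in> minimizers (penalized_objective f m a b \<gamma> \<delta>) UNIV"
  shows "x \<in> feasible_set m a b"
proof (rule ccontr)
  assume infeas: "x \<notin> feasible_set m a b"
  define X Y where "X = feasible_set m a b" and "Y = feasible_set m a (\<lambda>i. b i - \<delta>)"
  define p where "p = closest_point X x"
  define D where "D = norm (x - p)"
  define L where "L = subgradient_bound f R"
  define H where "H y = (\<Sum>i=1..m. h_penalty \<delta> (a i) (b i) y)" for y
  define A where "A = alpha_min m a"
  define B where "B = alpha_max m a"
  define M where "M = real m"
  have YX: "Y \<subseteq> X" using d by (fastforce simp: X_def Y_def feasible_set_def halfspace_le_def)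
  have ne: "X \<noteq> {}" using YX tight unfolding Y_def by auto
  have pX: "p \<in> X"
    unfolding p_def using ne closed_feasible_set by (intro closest_point_in_set) (auto simp: X_def)
  have M0: "M > 0" and A0: "A > 0" and b0: "\<beta> > 0"
    using m alpha_min_pos[OF m a] hoff by (auto simp: M_def A_def hoffman_constant_def)
  obtain i where i: "i \<in> {1..m}" and viol: "a i \<bullet> x - b i > 0"
    using infeas by (auto simp: feasible_set_def halfspace_le_def not_le)
  have B0: "B > 0" using alpha_max_ge[OF i, of a] bspec[OF a i] unfolding B_def
    by (meson less_le_trans zero_less_norm_iff)
  have D0: "D > 0" using pX infeas by (auto simp: D_def X_def)
  have s0: "sqrt \<delta> > 0" "sqrt \<delta> * sqrt \<delta> = \<delta>" using d by auto
  have radp: "norm p \<le> R"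
    and radz: "\<And>z. z \<in> X \<Longrightarrow> norm (x - z) \<le> D + \<beta> * M * \<delta> / A \<Longrightarrow> norm z \<le> R"
    using rad d g x unfolding subgradient_radius_def p_def D_def X_def M_def A_def
    by (auto simp: mem_cball)
  have L0: "0 \<le> L"
    using subdifferential_nonempty[OF conv, of p] norm_subgradient_le_bound[OF conv _ radp]
    unfolding L_def by (meson ex_in_conv norm_ge_zero order.trans)
  show False
  proof (cases "D > sqrt \<delta>")
    case True
    define G where "G = 1 / (M * \<beta>) - sqrt \<delta> / (4 * A)"
    have G0: "G > 0" using small by (simp add: G_def A_def M_def)
    have "D \<le> \<beta> * H x"
      using hoffman_total_penalty[OF hoff d(1) a, of b x] ne
      by (simp add: H_def X_def D_def p_def proj_dist_def)
    then have "D / \<beta> \<le> H x" using b0 by (simp add: field_simps)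
    moreover have "H p \<le> M * (\<delta> / (4 * A))"
      using total_penalty_feasible_le[OF d(1) m a] pX by (simp add: H_def M_def A_def X_def)
    moreover have "\<delta> < D * sqrt \<delta>" using mult_strict_right_mono[OF True s0(1)] s0(2) by simp
    then have "M * (\<delta> / (4 * A)) < M * (D * sqrt \<delta> / (4 * A))"
      using M0 A0 by (intro mult_strict_left_mono divide_strict_right_mono) auto
    moreover have "M * (G * D) = D / \<beta> - M * (D * sqrt \<delta> / (4 * A))"
      using M0 b0 A0 by (simp add: G_def field_simps)
    ultimately have "M * (G * D) < H x - H p" by linarith
    then have "\<gamma> / M * (M * (G * D)) < \<gamma> / M * (H x - H p)"
      using g M0 by (intro mult_strict_left_mono) auto
    also have "\<dots> \<le> L * D"
      using penalty_drop_le_move[OF conv x radp] by (simp add: H_def M_def L_def D_def)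
    finally have "\<gamma> * G < L" using M0 D0 by (simp add: mult.assoc[symmetric])
    moreover have "L * inverse G \<le> \<gamma>"
      using thr by (simp add: penalty_threshold_def L_def G_def A_def M_def)
    then have "L \<le> \<gamma> * G" using G0 by (simp add: field_simps)
    ultimately show False by simp
  next
    case False
    define K where "K = 1 / sqrt \<delta> + \<beta> * M / A"
    obtain z where z: "z \<in> Y" "norm (p - z) \<le> \<beta> * M * \<delta> / A"
      using tightened_point_near_feasible[OF hoff d(1) m a tight] pX
      unfolding Y_def X_def M_def A_def by blast
    have xz: "norm (x - z) \<le> D + \<beta> * M * \<delta> / A"
      using z(2) norm_triangle_ineq[of "x - p" "p - z"] by (simp add: D_def)
    have "H z = 0"
      unfolding H_def
      using feasible_setD[of z m a "\<lambda>i. b i - \<delta>"] z(1) d(1)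
      by (intro sum.neutral ballI h_penalty_tightened_eq_0) (auto simp: Y_def)
    moreover have "\<delta> / (4 * B) < H x"
    proof -
      have "\<delta> / (4 * B) \<le> \<delta> / (4 * norm (a i))"
        using d bspec[OF a i] alpha_max_ge[OF i, of a] by (intro frac_le) (auto simp: B_def)
      also have "\<dots> < h_penalty \<delta> (a i) (b i) x"
        using d(1) bspec[OF a i] viol by (rule h_penalty_infeasible_gt)
      also have "\<dots> \<le> H x"
        unfolding H_def using i d a by (intro member_le_sum h_penalty_nonneg) auto
      finally show ?thesis .
    qed
    ultimately have "\<gamma> / M * (\<delta> / (4 * B)) < \<gamma> / M * (H x - H z)"
      using g M0 by (intro mult_strict_left_mono) auto
    also have "\<dots> \<le> L * norm (x - z)"
      using penalty_drop_le_move[OF conv x radz[OF _ xz]] z(1) YX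
      by (auto simp: H_def M_def L_def)
    also have "\<dots> \<le> L * (sqrt \<delta> + \<beta> * M * \<delta> / A)"
      using L0 xz False by (intro mult_left_mono) auto
    also have "sqrt \<delta> + \<beta> * M * \<delta> / A = \<delta> * K"
      using s0 by (simp add: K_def distrib_left real_div_sqrt d less_imp_le)
    finally have "\<delta> * \<gamma> < \<delta> * (4 * M * L * B * K)"
      using M0 B0 by (simp add: field_simps)
    then have "\<gamma> < 4 * M * L * B * K" using d(1) by simp
    moreover have "4 * M * L * B * K \<le> \<gamma>"
      using thr by (simp add: penalty_threshold_def K_def L_def B_def A_def M_def)
    ultimately show False by simp
  qed
qed

section \<open>Distance between the two minimizers\<close>

theorem proposition2:
  fixes f :: "real ^ 'n \<Rightarrow> real"
    and m :: nat
    and a :: "nat \<Rightarrow> real ^ 'n"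
    and b :: "nat \<Rightarrow> real"
    and \<beta> \<mu>\<^sub>f \<delta>\<^sub>0 \<epsilon> c R L \<gamma> \<delta> :: real
    and x_bar :: "real ^ 'n"
  assumes "m \<ge> 2"
    and "\<And>i. i \<in> {1..m} \<Longrightarrow> a i \<noteq> 0"
    and "feasible_set m a b \<noteq> {}"
    and "hoffman_constant m a \<beta>"
    and "\<delta>\<^sub>0 > 0"
    and "convex_on UNIV f"
    and "\<mu>\<^sub>f > 0"
    and "strongly_convex \<mu>\<^sub>f f"
    and "\<epsilon> > 0"
    and "\<And>j. j \<in> {1..m} \<Longrightarrow> a j \<bullet> x_bar - b j \<le> - \<epsilon>"
    and "c > 2 * \<mu>\<^sub>f * alpha_min m a * \<delta>\<^sub>0"
    and "subgradient_radius f m a b \<beta> c \<epsilon> R"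
    and "L = subgradient_bound f R"
    and "\<gamma> > 0"
    and "0 < \<delta>"
    and "\<delta> < min \<epsilon> (16 * (alpha_min m a)\<^sup>2 / (\<beta>\<^sup>2 * (real m)\<^sup>2))"
    and "penalty_threshold m a \<beta> L \<delta> \<le> \<gamma>"
    and "\<gamma> \<le> 2 * \<mu>\<^sub>f * alpha_min m a * \<delta>\<^sub>0 / \<delta>"
  shows "\<exists>x_star x_pen.
      minimizers f (feasible_set m a b) = {x_star} \<and>
      minimizers (penalized_objective f m a b \<gamma> \<delta>) UNIV = {x_pen} \<and>
      (norm (x_pen - x_star))\<^sup>2 \<le> \<delta>\<^sub>0"
proof -
  have a: "\<forall>i\<in>{1..m}. a i \<noteq> 0" using assms(2) by blast
  note m = assms(1) and ne = assms(3) and hoff = assms(4)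
    and conv = assms(6) and mu = assms(7) and strong = assms(8)
  define X where "X = feasible_set m a b"
  define A where "A = alpha_min m a"
  define F where "F = penalized_objective f m a b \<gamma> \<delta>"
  define P where "P x = \<gamma> / real m * (\<Sum>i=1..m. h_penalty \<delta> (a i) (b i) x)" for x
  have F: "F = (\<lambda>x. f x + P x)" by (auto simp: F_def P_def penalized_objective_def)
  have d0: "\<delta> > 0" and g0: "\<gamma> > 0" and m1: "m \<ge> 1" and de: "\<delta> \<le> \<epsilon>"
    using assms(14-16) m by auto
  have A0: "A > 0" using alpha_min_pos[OF m1 a] by (simp add: A_def)
  have b0: "\<beta> > 0" using hoff by (simp add: hoffman_constant_def)
  have Pconv: "convex_on UNIV P"
    unfolding P_def using d0 g0 a by (intro convex_on_total_penalty) auto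
  have midf: "midpoint_strongly_convex \<mu>\<^sub>f f"
    using midpoint_strongly_convex_add[OF conv strong convex_on_const[THEN iffD2], of 0] by simp
  have midF: "midpoint_strongly_convex \<mu>\<^sub>f F"
    unfolding F by (rule midpoint_strongly_convex_add[OF conv strong Pconv])
  have X: "convex X" "closed X" "X \<noteq> {}"
    using ne by (auto simp: X_def convex_feasible_set closed_feasible_set)
  obtain x_star where xs: "minimizers f X = {x_star}"
    using minimizers_singleton[OF conv midf mu X] by blast
  have "convex_on UNIV F" unfolding F using conv Pconv by (rule convex_on_add)
  then obtain x_pen where xp: "minimizers F UNIV = {x_pen}"
    using minimizers_singleton[OF _ midF mu, of UNIV] by auto
  have gd: "\<gamma> * \<delta> \<le> 2 * \<mu>\<^sub>f * A * \<delta>\<^sub>0"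
    using assms(18) d0 by (simp add: A_def field_simps)
  have "x_bar \<in> feasible_set m a (\<lambda>i. b i - \<delta>)"
    using assms(10) de by (fastforce simp: feasible_set_def halfspace_le_def)
  moreover have "sqrt \<delta> / (4 * alpha_min m a) < 1 / (real m * \<beta>)"
  proof -
    have "\<delta> < (4 * A / (\<beta> * real m))\<^sup>2"
      using assms(16) by (simp add: A_def power_divide power_mult_distrib)
    then have "sqrt \<delta> < 4 * A / (\<beta> * real m)"
      using A0 b0 by (intro real_less_lsqrt) (auto simp: d0 less_imp_le)
    then show ?thesis using A0 b0 m1 by (simp add: A_def field_simps)
  qed
  ultimately have xpX: "x_pen \<in> X"
    unfolding X_def
    using assms(11,12,13,17) gd xp d0 g0 de a
    by (intro penalized_minimizer_feasible[OF conv hoff m1, where c = c and \<epsilon> = \<epsilon> and R = R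
          and \<gamma> = \<gamma> and \<delta> = \<delta>]) (auto simp: F_def A_def)
  define N where "N = (norm (x_pen - x_star))\<^sup>2"
  have xsX: "x_star \<in> X" using xs minimizers_memD(1)[of x_star f X] by simp
  have "f x_star + \<mu>\<^sub>f / 4 * N \<le> f x_pen"
    using minimizer_quadratic_growth[OF midf X(1), of x_star x_pen] xs xpX
    by (simp add: N_def norm_minus_commute)
  moreover have "F x_pen + \<mu>\<^sub>f / 4 * N \<le> F x_star"
    using minimizer_quadratic_growth[OF midF convex_UNIV, of x_pen x_star] xp by (simp add: N_def)
  moreover have "0 \<le> P x_pen"
    unfolding P_def using d0 g0 a by (intro mult_nonneg_nonneg sum_nonneg h_penalty_nonneg) auto
  moreover have "P x_star \<le> \<mu>\<^sub>f / 2 * \<delta>\<^sub>0"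
  proof -
    have "P x_star \<le> \<gamma> / real m * (real m * (\<delta> / (4 * A)))"
      unfolding P_def A_def using g0 total_penalty_feasible_le[OF d0 m1 a] xsX
      by (intro mult_left_mono) (auto simp: X_def)
    also have "\<dots> = \<gamma> * \<delta> / (4 * A)" using m1 by simp
    also have "\<dots> \<le> 2 * \<mu>\<^sub>f * A * \<delta>\<^sub>0 / (4 * A)" using gd A0 by (intro divide_right_mono) auto
    also have "\<dots> = \<mu>\<^sub>f / 2 * \<delta>\<^sub>0" using A0 by simp
    finally show ?thesis .
  qed
  ultimately have "\<mu>\<^sub>f / 2 * N \<le> \<mu>\<^sub>f / 2 * \<delta>\<^sub>0" unfolding F by simp
  then have "N \<le> \<delta>\<^sub>0" using mu by simp
  then show ?thesis using xs xp by (auto simp: N_def X_def F_def)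
qed

end
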